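(* Non-trivial $m\times n$ toroidal chessboards satisfying the neighbor-sum property exist if and only if $4\mid m$ and $6\mid n$.
   Context: An $m\times n$ toroidal chessboard is obtained from a rectangular $m\times n$ board by wrapping it around along both dimensions: it is an assignment of an integer to each square $(i,j)\in(\mathbb{Z}/m\mathbb{Z})\times(\mathbb{Z}/n\mathbb{Z})$. Two distinct squares $(i,j)\neq(i',j')$ are neighbors if $i-i'\in\{-1,0,1\}$ modulo $m$ and $j-j'\in\{-1,0,1\}$ modulo $n$. The board satisfies the neighbor-sum property if the number on each square equals the sum of the numbers on all its neighboring squares. It is trivial if all its entries are $0$, and non-trivial otherwise.
   Formalization: The condition is made symmetric: 4|m and 6|n, or 6|m and 4|n, since a 6×4 board is a counterexample to the original; and m, n ≥ 3 is assumed, since with neighbors counted as a set, degenerate sizes such as 1×2, 1×6 and 2×4 have non-trivial boards. *)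

theory Defs
  imports "HOL-Number_Theory.Cong"
begin

text \<open>
  For positive \<open>m\<close> and \<open>n\<close>, the squares \<open>(\<int>/m\<int>) \<times> (\<int>/n\<int>)\<close> are represented by the pairs of least
  non-negative residues. A board is a function on all pairs of integers of which only the values
  on these squares matter; it is not assumed to be periodic.
\<close>

definition squares :: "nat \<Rightarrow> nat \<Rightarrow> (int \<times> int) set" where
  "squares m n = {0..<int m} \<times> {0..<int n}"

definition neighbors :: "nat \<Rightarrow> nat \<Rightarrow> int \<times> int \<Rightarrow> int \<times> int \<Rightarrow> bool" where
  "neighbors m n s t \<longleftrightarrow> s \<noteq> t \<and>
     (\<exists>d\<in>{-1, 0, 1}. [fst s - fst t = d] (mod int m)) \<and>
     (\<exists>d\<in>{-1, 0, 1}. [snd s - snd t = d] (mod int n))"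

text \<open>
  The neighbors of a square form a set, so none is counted twice. If \<open>m\<close> and \<open>n\<close> are at least 3,
  every square has exactly 8 neighbors.
\<close>

definition neighbor_sum_property :: "nat \<Rightarrow> nat \<Rightarrow> (int \<times> int \<Rightarrow> int) \<Rightarrow> bool" where
  "neighbor_sum_property m n x \<longleftrightarrow>
     (\<forall>s\<in>squares m n. x s = (\<Sum>t | t \<in> squares m n \<and> neighbors m n s t. x t))"

definition trivial_board :: "nat \<Rightarrow> nat \<Rightarrow> (int \<times> int \<Rightarrow> int) \<Rightarrow> bool" where
  "trivial_board m n x \<longleftrightarrow> (\<forall>s\<in>squares m n. x s = 0)"

end

theory Submission
  imports Defs "Jordan_Normal_Form.Char_Poly"
begin

text \<open>
  The discrete Fourier transform of a non-trivial board is non-zero at some pair \<open>(z, w)\<close> of roots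
  of unity with \<open>z ^ m = 1\<close> and \<open>w ^ n = 1\<close>, and there \<open>u v = 2\<close>, where \<open>u = 1 + z + 1 / z\<close> and
  \<open>v = 1 + w + 1 / w\<close>. Both factors lie in a ring \<open>\<int>[\<xi>]\<close> of algebraic integers and divide \<open>2\<close>. Let \<open>h\<close>
  be the order of \<open>z ^ 3\<close>. As \<open>u z (1 - z) = 1 - z ^ 3\<close>, the factor \<open>u\<close> divides \<open>1 - t\<close> for every power
  \<open>t\<close> of \<open>z ^ 3\<close>. If \<open>h\<close> has an odd divisor \<open>d > 1\<close>, this makes \<open>u\<close> divide \<open>d\<close>, so \<open>u\<close> is a unit; if
  \<open>8\<close> divides \<open>h\<close>, it makes \<open>u ^ 4\<close> divide \<open>2\<close>; and for \<open>h \<in> {1, 2, 4}\<close> the value of \<open>u\<close> is explicit.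
  Comparing powers of \<open>2\<close> in \<open>u v = 2\<close> leaves only \<open>{u, v} = {1, 2}\<close>, that is, roots of unity of
  orders \<open>4\<close> and \<open>6\<close>. The corresponding real waves have integer values and give the boards.
\<close>

section \<open>Rings generated by a root of unity, and their integrality\<close>

inductive_set int_adjoin :: "complex \<Rightarrow> complex set" for \<xi> :: complex where
  of_int: "of_int k \<in> int_adjoin \<xi>"
| gen: "\<xi> \<in> int_adjoin \<xi>"
| add: "a \<in> int_adjoin \<xi> \<Longrightarrow> b \<in> int_adjoin \<xi> \<Longrightarrow> a + b \<in> int_adjoin \<xi>"
| mult: "a \<in> int_adjoin \<xi> \<Longrightarrow> b \<in> int_adjoin \<xi> \<Longrightarrow> a * b \<in> int_adjoin \<xi>"

lemma int_adjoin_0: "0 \<in> int_adjoin \<xi>"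
  using int_adjoin.of_int[of 0 \<xi>] by simp

lemma int_adjoin_1: "1 \<in> int_adjoin \<xi>"
  using int_adjoin.of_int[of 1 \<xi>] by simp

lemma int_adjoin_numeral: "numeral k \<in> int_adjoin \<xi>"
  using int_adjoin.of_int[of "numeral k" \<xi>] by simp

lemma int_adjoin_minus: "a \<in> int_adjoin \<xi> \<Longrightarrow> - a \<in> int_adjoin \<xi>"
  using int_adjoin.mult[OF int_adjoin.of_int[of "-1" \<xi>]] by simp

lemma int_adjoin_diff: "a \<in> int_adjoin \<xi> \<Longrightarrow> b \<in> int_adjoin \<xi> \<Longrightarrow> a - b \<in> int_adjoin \<xi>"
  using int_adjoin.add[OF _ int_adjoin_minus] by fastforce

lemma int_adjoin_power: "a \<in> int_adjoin \<xi> \<Longrightarrow> a ^ i \<in> int_adjoin \<xi>"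
  by (induction i) (auto intro: int_adjoin.mult int_adjoin_1)

lemma int_adjoin_sum: "(\<And>i. i \<in> I \<Longrightarrow> f i \<in> int_adjoin \<xi>) \<Longrightarrow> sum f I \<in> int_adjoin \<xi>"
  by (induction I rule: infinite_finite_induct) (auto intro: int_adjoin.add int_adjoin_0)

lemmas int_adjoin_intros =
  int_adjoin_0 int_adjoin_1 int_adjoin_numeral int_adjoin_minus int_adjoin_diff
  int_adjoin_power int_adjoin_sum int_adjoin.add int_adjoin.mult

text \<open>The powers of \<open>\<xi>\<close> below \<open>N\<close> are an eigenvector, with eigenvalue \<open>y\<close>, of an integer matrix;
  so \<open>y\<close> is a root of the characteristic polynomial.\<close>

lemma algebraic_int_int_adjoin:
  assumes \<xi>: "\<xi> ^ N = 1" and N: "N > 0" and y: "y \<in> int_adjoin \<xi>"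
  shows "algebraic_int y"
proof -
  \<comment> \<open>\<open>M\<close> is the additive group spanned by the first \<open>N\<close>
    powers of \<open>\<xi>\<close>. Because \<open>\<xi> ^ N = 1\<close>, it is stable under
    \<open>\<xi>\<close>, hence under the whole ring; being finitely generated, it turns
    multiplication by \<open>y\<close> into an integer matrix.\<close>
  define M where "M = {\<Sum>j<N. of_int (c j) * \<xi> ^ j | c :: nat \<Rightarrow> int. True}"
  have M_I: "(\<Sum>j<N. of_int (c j) * \<xi> ^ j) \<in> M" for c :: "nat \<Rightarrow> int"
    unfolding M_def by blast
  have M_add: "a + b \<in> M" if "a \<in> M" "b \<in> M" for a b
  proof -
    obtain c :: "nat \<Rightarrow> int" where "a = (\<Sum>j<N. of_int (c j) * \<xi> ^ j)"
      using \<open>a \<in> M\<close> unfolding M_def by blast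
    moreover obtain c' :: "nat \<Rightarrow> int" where "b = (\<Sum>j<N. of_int (c' j) * \<xi> ^ j)"
      using \<open>b \<in> M\<close> unfolding M_def by blast
    ultimately have "a + b = (\<Sum>j<N. of_int (c j + c' j) * \<xi> ^ j)"
      by (simp add: sum.distrib algebra_simps)
    then show ?thesis using M_I by metis
  qed
  have M_int: "of_int k * a \<in> M" if "a \<in> M" for k a
  proof -
    obtain c :: "nat \<Rightarrow> int" where "a = (\<Sum>j<N. of_int (c j) * \<xi> ^ j)"
      using \<open>a \<in> M\<close> unfolding M_def by blast
    then have "of_int k * a = (\<Sum>j<N. of_int (k * c j) * \<xi> ^ j)"
      by (simp add: sum_distrib_left algebra_simps)
    then show ?thesis using M_I by metis
  qed
  have M_sum: "(\<And>i. i \<in> I \<Longrightarrow> f i \<in> M) \<Longrightarrow> sum f I \<in> M" for I :: "nat set" and f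
  proof (induction I rule: infinite_finite_induct)
    case (insert i I)
    then show ?case by (auto intro: M_add)
  qed (use M_I[of "\<lambda>_. 0"] in auto)
  have M_power: "\<xi> ^ i \<in> M" for i
  proof -
    have "\<xi> ^ i = \<xi> ^ (N * (i div N) + i mod N)" by simp
    also have "\<dots> = \<xi> ^ (i mod N)" by (simp only: power_add power_mult \<xi>) simp
    also have "\<dots> = (\<Sum>j<N. of_int (if j = i mod N then 1 else 0) * \<xi> ^ j)"
      using N by (simp add: if_distrib [where f = of_int] if_distrib [where f = "\<lambda>u. u * _"] sum.delta cong: if_cong)
    finally show ?thesis using M_I by metis
  qed
  have M_gen: "\<xi> * a \<in> M" if "a \<in> M" for a
  proof -
    obtain c :: "nat \<Rightarrow> int" where "a = (\<Sum>j<N. of_int (c j) * \<xi> ^ j)"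
      using \<open>a \<in> M\<close> unfolding M_def by blast
    then have "\<xi> * a = (\<Sum>j<N. of_int (c j) * \<xi> ^ Suc j)"
      by (simp add: sum_distrib_left algebra_simps)
    moreover have "(\<Sum>j<N. of_int (c j) * \<xi> ^ Suc j) \<in> M" by (intro M_sum M_int M_power)
    ultimately show ?thesis by (simp only:)
  qed
  have stable: "y * a \<in> M" if "a \<in> M" for a
    using y that by (induction arbitrary: a rule: int_adjoin.induct)
      (auto simp: M_int M_gen distrib_right mult.assoc intro: M_add)
  have "\<exists>c :: nat \<Rightarrow> int. y * \<xi> ^ i = (\<Sum>j<N. of_int (c j) * \<xi> ^ j)" for i
    using stable[OF M_power[of i]] unfolding M_def by blast
  then obtain c :: "nat \<Rightarrow> nat \<Rightarrow> int" where c: "\<And>i. y * \<xi> ^ i = (\<Sum>j<N. of_int (c i j) * \<xi> ^ j)"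
    by metis
  define C where "C = mat N N (\<lambda>(i, j). c i j)"
  define A :: "complex mat" where "A = map_mat of_int C"
  define w where "w = vec N (\<lambda>i. \<xi> ^ i)"
  have C: "C \<in> carrier_mat N N" unfolding C_def by simp
  have A: "A \<in> carrier_mat N N" unfolding A_def using C by simp
  have "eigenvector A w y"
    unfolding eigenvector_def
  proof (intro conjI)
    show "w \<in> carrier_vec (dim_row A)" using A unfolding w_def by simp
    \<comment> \<open>Entry 0 of \<open>w\<close> is \<open>\<xi> ^ 0 = 1\<close>.\<close>
    have "w $ 0 \<noteq> 0\<^sub>v (dim_row A) $ 0" using A N unfolding w_def by simp
    then show "w \<noteq> 0\<^sub>v (dim_row A)" by metis
    show "A *\<^sub>v w = y \<cdot>\<^sub>v w"
      by (rule eq_vecI) (auto simp: A_def C_def w_def scalar_prod_def c lessThan_atLeast0)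
  qed
  then have "poly (char_poly A) y = 0"
    using eigenvalue_root_char_poly[OF A] unfolding eigenvalue_def by blast
  moreover have "char_poly A = map_poly of_int (char_poly C)"
    unfolding A_def using of_int_hom.char_poly_hom[OF C] .
  moreover have "lead_coeff (char_poly C) = 1"
    using degree_monic_char_poly[OF C] by simp
  ultimately show ?thesis
    unfolding algebraic_int_altdef_ipoly by metis
qed

text \<open>The least positive exponent works: a non-zero remainder modulo it that also gave 1 would
  be smaller still.\<close>

lemma power_eq_1_order:
  fixes z :: complex
  assumes "z ^ K = 1" "K > 0"
  obtains h where "h > 0" "\<And>i. z ^ i = 1 \<longleftrightarrow> h dvd i"
proof -
  define h where "h = (LEAST h. h > 0 \<and> z ^ h = 1)"
  have h: "h > 0" "z ^ h = 1"
    using LeastI[of "\<lambda>h. h > 0 \<and> z ^ h = 1" K] assms unfolding h_def by auto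
  have "z ^ i = 1 \<longleftrightarrow> h dvd i" for i
  proof -
    have "z ^ i = z ^ (h * (i div h) + i mod h)" by simp
    also have "\<dots> = z ^ (i mod h)" by (simp only: power_add power_mult h) simp
    finally have *: "z ^ i = z ^ (i mod h)" .
    have "i mod h = 0" if "z ^ (i mod h) = 1"
      using not_less_Least[of "i mod h" "\<lambda>h. h > 0 \<and> z ^ h = 1"] that h(1) unfolding h_def[symmetric] by auto
    then show ?thesis using * by (metis dvd_eq_mod_eq_0 power_0)
  qed
  then show ?thesis using that h(1) by blast
qed

section \<open>Divisibility in the ring and the factorizations of 2\<close>

locale cyclotomic =
  fixes \<xi> :: complex and N :: nat
  assumes root: "\<xi> ^ N = 1" and N_pos: "N > 0"
begin

abbreviation R :: "complex set" where "R \<equiv> int_adjoin \<xi>"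

text \<open>In the field of complex numbers every non-zero number divides everything, so the
  cofactor has to be confined to the ring.\<close>

definition adj_dvd :: "complex \<Rightarrow> complex \<Rightarrow> bool" (infix "divs" 50) where
  "a divs b \<longleftrightarrow> (\<exists>c\<in>R. b = a * c)"

lemma divsI: "b = a * c \<Longrightarrow> c \<in> R \<Longrightarrow> a divs b"
  unfolding adj_dvd_def by blast

lemma divs_trans: "a divs b \<Longrightarrow> b divs c \<Longrightarrow> a divs c"
  unfolding adj_dvd_def by (metis int_adjoin.mult mult.assoc)

lemma divs_mult: "a divs b \<Longrightarrow> c divs d \<Longrightarrow> a * c divs b * d"
  unfolding adj_dvd_def by (smt (verit) int_adjoin.mult mult.assoc mult.left_commute)

lemma divs_power: "a divs b \<Longrightarrow> a ^ i divs b ^ i"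
  unfolding adj_dvd_def by (metis int_adjoin_power power_mult_distrib)

text \<open>The cofactor \<open>1 / d\<close> is rational and an algebraic integer, hence an
  integer. This is where integrality of the ring enters.\<close>

lemma of_nat_divs_1_imp_1:
  assumes "of_nat d divs 1"
  shows "d = 1"
proof -
  obtain c where c: "c \<in> R" "1 = of_nat d * c"
    using assms unfolding adj_dvd_def by blast
  then have "d \<noteq> 0" by (auto intro: ccontr)
  then have eq: "c = 1 / of_nat d" using c(2) by (simp add: field_simps)
  then have "c \<in> \<rat>" by simp
  then obtain k where "c = of_int k"
    using rational_algebraic_int_is_int[OF algebraic_int_int_adjoin[OF root N_pos c(1)]]
    by (auto elim: Ints_cases)
  then have "of_int (int d * k) = (of_int 1 :: complex)" using c(2) by simp
  then have "int d * k = 1" by (simp only: of_int_eq_iff)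
  then show ?thesis by (simp add: zmult_eq_1_iff)
qed

text \<open>The form in which powers of 2 are compared: it refutes, for example, that 16 divides
  2.\<close>

lemma of_nat_mult_divs_imp_1:
  assumes "of_nat (d * e) divs of_nat e" and "e > 0"
  shows "d = 1"
proof -
  obtain c where "c \<in> R" "of_nat e = of_nat (d * e) * c"
    using assms(1) unfolding adj_dvd_def by blast
  then have "of_nat e * 1 = of_nat e * (of_nat d * c)" by (simp add: mult_ac)
  then have "1 = of_nat d * c" using assms(2) by (subst (asm) mult_cancel_left) auto
  then show ?thesis using \<open>c \<in> R\<close> by (intro of_nat_divs_1_imp_1 divsI)
qed

lemma one_minus_divs_power: "z \<in> R \<Longrightarrow> 1 - z divs 1 - z ^ i"
  by (rule divsI[OF one_diff_power_eq]) (intro int_adjoin_intros)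

text \<open>The powers of \<open>z\<close> with exponents below \<open>d\<close> sum to 0, so
  \<open>d\<close> is the sum of the differences \<open>1 - z ^ i\<close>, each of them a multiple
  of \<open>1 - z\<close>.\<close>

lemma one_minus_divs_order:
  assumes z: "z \<in> R" "z ^ d = 1" "z \<noteq> 1"
  shows "1 - z divs of_nat d"
proof (rule divsI)
  have "(1 - z) * (\<Sum>i<d. z ^ i) = 0" using one_diff_power_eq[of z d] z(2) by simp
  then have "(\<Sum>i<d. z ^ i) = 0" using z(3) by simp
  then have "of_nat d = (\<Sum>i<d. 1 - z ^ i)" by (simp add: sum_subtractf)
  also have "\<dots> = (\<Sum>i<d. (1 - z) * (\<Sum>j<i. z ^ j))" by (intro sum.cong one_diff_power_eq refl)
  also have "\<dots> = (1 - z) * (\<Sum>i<d. \<Sum>j<i. z ^ j)" by (simp only: sum_distrib_left)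
  finally show "of_nat d = (1 - z) * (\<Sum>i<d. \<Sum>j<i. z ^ j)" .
qed (intro int_adjoin_intros z)

text \<open>With the 2-adic valuation normalized to 1 at 2, the alternatives bound the valuation of
  \<open>u\<close>: it is 0, at most 1/4, exactly 1/2, or 1.\<close>

lemma divs_2_cases:
  assumes z: "z \<in> R" and K: "z ^ K = 1" "K > 0"
    and u: "u = 1 + z + 1 / z" and u2: "u divs 2"
  shows "u divs 1 \<or> u ^ 4 divs 2 \<or> u\<^sup>2 = 2 * u + 2 \<or> (u = 2 \<and> z ^ 3 = -1)"
proof -
  have z0: "z \<noteq> 0" using K by (auto simp: power_0_left)
  have uz: "u * z = 1 + z + z\<^sup>2" using z0 unfolding u by (simp add: field_simps power2_eq_square)
  have "1 - z ^ 3 = u * (z * (1 - z))" using uz by Groebner_Basis.algebra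
  then have u_divs: "u divs 1 - z ^ 3" by (rule divsI) (intro int_adjoin_intros z)
  have "(z ^ 3) ^ K = 1" using K(1) by (metis power_one power_mult mult.commute)
  then obtain h where h: "h > 0" "\<And>i. (z ^ 3) ^ i = 1 \<longleftrightarrow> h dvd i"
    using power_eq_1_order K(2) by blast
  have u_divs_power: "u divs 1 - (z ^ 3) ^ i" for i
    using divs_trans[OF u_divs one_minus_divs_power] int_adjoin_power[OF z] by blast
  have not0: "u \<noteq> 0" using u2 unfolding adj_dvd_def by auto
  \<comment> \<open>Write \<open>h\<close> as a power of 2 times an odd number: either the power is
    at least 8, or the odd part exceeds 1, or \<open>h\<close> is 1, 2 or 4.\<close>
  consider "8 dvd h" | d q where "h = d * q" "odd d" "d > 1" | "h = 1" | "h = 2" | "h = 4"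
  proof -
    have "8 dvd h \<or> odd h \<or> (\<exists>k. odd k \<and> h = k * 2) \<or> (\<exists>k. odd k \<and> h = k * 4)"
      by presburger
    then show ?thesis
    proof (elim disjE exE conjE)
      assume "odd h" then show ?thesis using that(2)[of h 1] that(3) by (cases "h = 1") (auto elim: oddE)
    next
      fix k assume "odd k" "h = k * 2"
      then show ?thesis using that(2)[of k 2] that(4) by (cases "k = 1") (auto elim: oddE)
    next
      fix k assume "odd k" "h = k * 4"
      then show ?thesis using that(2)[of k 4] that(5) by (cases "k = 1") (auto elim: oddE)
    qed (use that(1) in blast)
  qed
  then show ?thesis
  proof cases
    case 1
    then obtain q where q: "h = 8 * q" by blast
    \<comment> \<open>\<open>t\<close> has order exactly 8, whence
      \<open>t ^ 4 = -1\<close>.\<close>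
    define t where "t = (z ^ 3) ^ q"
    have "(t ^ 4)\<^sup>2 = (z ^ 3) ^ h"
      unfolding t_def q by (simp only: power_mult[symmetric]) (simp add: ac_simps)
    then have "(t ^ 4)\<^sup>2 = 1" using h(2) by simp
    moreover have "t ^ 4 \<noteq> 1"
      using h(2)[of "q * 4"] h(1) unfolding t_def q power_mult[symmetric]
      by (auto simp: mult.assoc dest: dvd_imp_le)
    ultimately have t4: "t ^ 4 = -1" unfolding power2_eq_1_iff by blast
    have t: "t \<in> R" unfolding t_def by (intro int_adjoin_intros z)
    \<comment> \<open>The cofactor is \<open>\<Prod>j\<in>{3, 5, 7}. 1 + t + \<dots> + t ^ (j - 1)\<close>, since \<open>2\<close> is the value at \<open>1\<close> of the
      eighth cyclotomic polynomial.\<close>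
    have "2 = (1 - t) ^ 4 * (- (1 + t + t\<^sup>2)\<^sup>2)" using t4 by Groebner_Basis.algebra
    then have "(1 - t) ^ 4 divs 2" by (rule divsI) (intro int_adjoin_intros t)
    then have "u ^ 4 divs 2"
      using divs_trans divs_power[OF u_divs_power[of q]] unfolding t_def by blast
    then show ?thesis by blast
  next
    case 2
    \<comment> \<open>\<open>t\<close> is a non-trivial \<open>d\<close>-th root of unity, so
      \<open>u\<close> divides \<open>d\<close> as well as 2; these are coprime because
      \<open>d\<close> is odd.\<close>
    define t where "t = (z ^ 3) ^ q"
    have "t ^ d = 1" unfolding t_def power_mult[symmetric]
      using h(2)[of h] 2(1) by (simp add: ac_simps flip: power_mult)
    moreover have "t \<noteq> 1"
      using h(2)[of q] h(1) 2 unfolding t_def by (auto dest: dvd_imp_le)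
    moreover have "t \<in> R" unfolding t_def by (intro int_adjoin_intros z)
    ultimately have "u divs of_nat d"
      using divs_trans[OF u_divs_power one_minus_divs_order] unfolding t_def by blast
    then obtain a where a: "a \<in> R" "of_nat d = u * a" unfolding adj_dvd_def by blast
    obtain b where b: "b \<in> R" "2 = u * b" using u2 unfolding adj_dvd_def by blast
    obtain e where "d = 2 * e + 1" using \<open>odd d\<close> by (elim oddE)
    then have "1 = u * (a - b * of_int (int e))" using a b by (simp add: algebra_simps)
    then have "u divs 1" by (rule divsI) (intro int_adjoin_intros int_adjoin.of_int a b)
    then show ?thesis by blast
  next
    case 3
    then have z3: "z ^ 3 = 1" using h(2)[of 1] by simp
    \<comment> \<open>A primitive cube root of unity would give \<open>u = 0\<close>. The remaining
      value \<open>u = 3\<close> cannot divide 2, since it would then divide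
      \<open>3 - 2 = 1\<close>.\<close>
    have "z = 1"
    proof (rule ccontr)
      assume "z \<noteq> 1"
      moreover have "u * z * (z - 1) = 0" using uz z3 by Groebner_Basis.algebra
      ultimately show False using not0 z0 by simp
    qed
    then have "u = 3" unfolding u by simp
    then obtain b where "b \<in> R" "2 = 3 * b" using u2 unfolding adj_dvd_def by blast
    then have "of_nat 3 divs 1" by (intro divsI[of _ _ "1 - b"]) (auto intro: int_adjoin_intros)
    then show ?thesis using of_nat_divs_1_imp_1 by fastforce
  next
    case 4
    have "(z ^ 3)\<^sup>2 = 1" "z ^ 3 \<noteq> 1" using 4 h(2)[of 2] h(2)[of 1] by auto
    then have z3: "z ^ 3 = -1" unfolding power2_eq_1_iff by blast
    show ?thesis
    proof (cases "z = -1")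
      case True
      then have "u = -1" unfolding u by simp
      then have "u divs 1" by (intro divsI[of _ _ "-1"]) (auto intro: int_adjoin_intros)
      then show ?thesis by blast
    next
      case False
      \<comment> \<open>This is \<open>z ^ 3 + 1 = (z + 1) * (z\<^sup>2 - z + 1)\<close>, with the
        second factor rewritten through \<open>u\<close>.\<close>
      have "(z + 1) * (z * (u - 2)) = 0" using uz z3 by Groebner_Basis.algebra
      then have "u = 2" using False z0 by (auto simp: eq_neg_iff_add_eq_0)
      then show ?thesis using z3 by blast
    qed
  next
    case 5
    have "((z ^ 3)\<^sup>2)\<^sup>2 = 1" "(z ^ 3)\<^sup>2 \<noteq> 1" using 5 h(2)[of 4] h(2)[of 2] by (auto simp flip: power_mult)
    then have z6: "(z ^ 3)\<^sup>2 = -1" unfolding power2_eq_1_iff by blast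
    \<comment> \<open>The product is \<open>z ^ 6 + 1\<close>, split into the 4th and 12th
      cyclotomic polynomials in \<open>z\<close>, each expressed through \<open>u\<close>. Order 4
      gives \<open>u = 1\<close>, and order 12 gives the roots \<open>1 \<plusminus> sqrt 3\<close>
      of the quadratic.\<close>
    have "(z * (u - 1)) * (z\<^sup>2 * (u\<^sup>2 - 2 * u - 2)) = 0" using uz z6 by Groebner_Basis.algebra
    then consider "u = 1" | "u\<^sup>2 - 2 * u - 2 = 0" using z0 by auto
    then show ?thesis
    proof cases
      case 1
      then have "u divs 1" by (intro divsI[of _ _ 1]) (auto intro: int_adjoin_intros)
      then show ?thesis by blast
    qed (auto simp: algebra_simps)
  qed
qed

text \<open>The valuations of \<open>u\<close> and \<open>v\<close> must add up to 1. If neither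
  factor is 2, every pair of alternatives falls short of that, except 1/2 + 1/2, which is refuted by
  the explicit quadratic equations.\<close>

lemma product_2_imp:
  assumes z: "z \<in> R" "1 / z \<in> R" and K: "z ^ K = 1" "K > 0"
    and w: "w \<in> R" "1 / w \<in> R" and L: "w ^ L = 1" "L > 0"
    and u: "u = 1 + z + 1 / z" and v: "v = 1 + w + 1 / w" and uv: "u * v = 2"
  shows "u = 2 \<and> v = 1 \<or> u = 1 \<and> v = 2"
proof -
  have R: "u \<in> R" "v \<in> R" unfolding u v using z w by (auto intro!: int_adjoin_intros)
  have "u divs 2" "v divs 2"
    using R uv by (auto intro!: divsI[of 2 u v] divsI[of 2 v u] simp: mult.commute)
  from divs_2_cases[OF z(1) K u this(1)] divs_2_cases[OF w(1) L v this(2)]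
  have cases: "u divs 1 \<or> u ^ 4 divs 2 \<or> u\<^sup>2 = 2 * u + 2 \<or> u = 2"
    "v divs 1 \<or> v ^ 4 divs 2 \<or> v\<^sup>2 = 2 * v + 2 \<or> v = 2" by blast+
  \<comment> \<open>Valuation 1/2 made concrete; the cofactor \<open>3 - a\<close> comes from
    reducing modulo the quadratic equation.\<close>
  have sq: "a\<^sup>2 divs 2" if "a \<in> R" "a\<^sup>2 = 2 * a + 2" for a
  proof (rule divsI)
    show "2 = a\<^sup>2 * (3 - a)" using that(2) by Groebner_Basis.algebra
  qed (intro int_adjoin_intros that)
  have no: "\<not> of_nat (d * e) divs of_nat e" if "d > 1" "e > 0" for d e
    using of_nat_mult_divs_imp_1[of d e] that by auto
  have uv4: "u ^ 4 * v ^ 4 = 16" using uv by (simp flip: power_mult_distrib)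
  have uv2: "u\<^sup>2 * v\<^sup>2 = 4" using uv by (simp flip: power_mult_distrib)
  have unit_unit: "\<not> (u divs 1 \<and> v divs 1)"
    using divs_mult[of u 1 v 1] uv no[of 2 1] by auto
  \<comment> \<open>Fourth powers clear the valuation 1/4: their product 16 would divide 2 here, 8
    in \<open>fourth_sq\<close> and 4 in \<open>fourth_fourth\<close>.\<close>
  have fourth_unit: "\<not> (a ^ 4 divs 2 \<and> b divs 1)" if "a ^ 4 * b ^ 4 = 16" for a b
    using divs_mult[of "a ^ 4" 2 "b ^ 4" 1] divs_power[of b 1 4] that no[of 8 2] by auto
  have fourth_sq: "\<not> (a ^ 4 divs 2 \<and> b\<^sup>2 divs 2)" if "a ^ 4 * b ^ 4 = 16" for a b
    using divs_mult[of "a ^ 4" 2 "b ^ 4" 4] divs_power[of "b\<^sup>2" 2 2] that no[of 2 8] by auto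
  have fourth_fourth: "\<not> (u ^ 4 divs 2 \<and> v ^ 4 divs 2)"
    using divs_mult[of "u ^ 4" 2 "v ^ 4" 2] uv4 no[of 4 4] by auto
  have sq_unit: "\<not> (a\<^sup>2 divs 2 \<and> b divs 1)" if "a\<^sup>2 * b\<^sup>2 = 4" for a b
    using divs_mult[of "a\<^sup>2" 2 "b\<^sup>2" 1] divs_power[of b 1 2] that no[of 2 2] by auto
  have sq_sq: "\<not> (u\<^sup>2 = 2 * u + 2 \<and> v\<^sup>2 = 2 * v + 2)"
  proof
    assume *: "u\<^sup>2 = 2 * u + 2 \<and> v\<^sup>2 = 2 * v + 2"
    \<comment> \<open>The quadratic equation for \<open>u\<close> reads
      \<open>u * (u - 2) = 2\<close>, and the right-hand side is \<open>u * v\<close>.\<close>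
    then have "u * (v - (u - 2)) = 0" using uv by Groebner_Basis.algebra
    then have "v = u - 2" using uv by auto
    then have "u = 2" using * by Groebner_Basis.algebra
    then show False using * by simp
  qed
  have "u = 2 \<or> v = 2"
    using cases unit_unit fourth_unit[OF uv4] fourth_unit[of v u] fourth_sq[OF uv4] fourth_sq[of v u]
      fourth_fourth sq_unit[OF uv2] sq_unit[of v u] sq_sq sq[OF R(1)] sq[OF R(2)] uv4 uv2
    by (metis mult.commute)
  then show ?thesis using uv by auto
qed

end

section \<open>Neighbors as shifts on the torus\<close>

lemma residue_diff_cong_iff:
  fixes a b :: int
  assumes "b \<in> {0..<int m}"
  shows "(\<exists>d\<in>{-1, 0, 1}. [a - b = d] (mod int m)) \<longleftrightarrow> (\<exists>d\<in>{-1, 0, 1}. b = (a + d) mod int m)"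
proof -
  have "[a - b = d] (mod int m) \<longleftrightarrow> b = (a + - d) mod int m" for d
  proof -
    have "[a - b = d] (mod int m) \<longleftrightarrow> [b = a + - d] (mod int m)"
      unfolding cong_iff_dvd_diff by (metis add.inverse_inverse diff_diff_eq2 diff_minus_eq_add dvd_minus_iff minus_diff_eq diff_add_eq add.commute)
    also have "\<dots> \<longleftrightarrow> b = (a + - d) mod int m"
      using assms unfolding cong_def by simp
    finally show ?thesis .
  qed
  then show ?thesis by auto
qed

text \<open>Two shifts differ by at most 2, which is less than the side length. On a side of length
  2 the shifts -1 and 1 would coincide.\<close>

lemma residue_shift_inject:
  fixes a d e :: int
  assumes "m \<ge> 3" "d \<in> {-1, 0, 1}" "e \<in> {-1, 0, 1}" "(a + d) mod int m = (a + e) mod int m"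
  shows "d = e"
proof -
  have "int m dvd d - e" using assms(4) by (simp add: mod_eq_dvd_iff)
  moreover have "\<bar>d - e\<bar> < int m" using assms(1-3) by auto
  ultimately show ?thesis using zdvd_imp_le[of "int m" "\<bar>d - e\<bar>"] by fastforce
qed

definition king_moves :: "(int \<times> int) set" where
  "king_moves = {-1, 0, 1} \<times> {-1, 0, 1} - {(0, 0)}"

lemma king_moves_eq:
  "king_moves = {(-1, -1), (-1, 0), (-1, 1), (0, -1), (0, 1), (1, -1), (1, 0), (1, 1)}"
  unfolding king_moves_def by auto

text \<open>On sides of length at least 3 the eight king moves lead to distinct squares, none of
  them the starting square, so the sum can be reindexed over a fixed explicit set.\<close>

lemma sum_neighbors:
  fixes f :: "int \<times> int \<Rightarrow> 'a :: comm_monoid_add"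
  assumes mn: "m \<ge> 3" "n \<ge> 3" and s: "(a, b) \<in> squares m n"
  shows "(\<Sum>t | t \<in> squares m n \<and> neighbors m n (a, b) t. f t) =
    (\<Sum>(d, e)\<in>king_moves. f ((a + d) mod int m, (b + e) mod int n))"
proof -
  let ?g = "\<lambda>(d, e). ((a + d) mod int m, (b + e) mod int n)"
  have ab: "a mod int m = a" "b mod int n = b" using s unfolding squares_def by auto
  have "bij_betw ?g king_moves {t \<in> squares m n. neighbors m n (a, b) t}"
  proof (rule bij_betw_imageI)
    show "inj_on ?g king_moves"
    proof (rule inj_onI)
      fix p q assume pq: "p \<in> king_moves" "q \<in> king_moves" "?g p = ?g q"
      have "fst p = fst q"
        by (rule residue_shift_inject[OF mn(1), of _ _ a])
          (use pq in \<open>auto simp: king_moves_def case_prod_unfold\<close>)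
      moreover have "snd p = snd q"
        by (rule residue_shift_inject[OF mn(2), of _ _ b])
          (use pq in \<open>auto simp: king_moves_def case_prod_unfold\<close>)
      ultimately show "p = q" by (rule prod_eqI)
    qed
  next
    show "?g ` king_moves = {t \<in> squares m n. neighbors m n (a, b) t}"
    proof (intro equalityI subsetI)
      fix t assume "t \<in> ?g ` king_moves"
      then obtain d e where de: "d \<in> {-1, 0, 1}" "e \<in> {-1, 0, 1}" "(d, e) \<noteq> (0, 0)"
        and t: "t = ((a + d) mod int m, (b + e) mod int n)"
        unfolding king_moves_def by auto
      have t_sq: "fst t \<in> {0..<int m}" "snd t \<in> {0..<int n}" using mn unfolding t by auto
      have "(a, b) \<noteq> t"
        using de residue_shift_inject[OF mn(1), of d 0 a] residue_shift_inject[OF mn(2), of e 0 b]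
        unfolding t by (auto simp: ab)
      moreover have "\<exists>d\<in>{-1, 0, 1}. [a - fst t = d] (mod int m)" "\<exists>d\<in>{-1, 0, 1}. [b - snd t = d] (mod int n)"
        unfolding residue_diff_cong_iff[OF t_sq(1)] residue_diff_cong_iff[OF t_sq(2)]
        using de(1,2) unfolding t fst_conv snd_conv by blast+
      ultimately show "t \<in> {t \<in> squares m n. neighbors m n (a, b) t}"
        using t_sq unfolding squares_def neighbors_def mem_Collect_eq mem_Times_iff fst_conv snd_conv by blast
    next
      fix t assume "t \<in> {t \<in> squares m n. neighbors m n (a, b) t}"
      then have "(a, b) \<noteq> t" and t: "fst t \<in> {0..<int m}" "snd t \<in> {0..<int n}"
        and "\<exists>d\<in>{-1, 0, 1}. [a - fst t = d] (mod int m)" "\<exists>d\<in>{-1, 0, 1}. [b - snd t = d] (mod int n)"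
        unfolding squares_def neighbors_def mem_Collect_eq mem_Times_iff fst_conv snd_conv by blast+
      then obtain d e where de: "d \<in> {-1, 0, 1}" "e \<in> {-1, 0, 1}"
        "fst t = (a + d) mod int m" "snd t = (b + e) mod int n"
        unfolding residue_diff_cong_iff[OF t(1)] residue_diff_cong_iff[OF t(2)] by blast
      then have "(d, e) \<in> king_moves"
        using \<open>(a, b) \<noteq> t\<close> ab unfolding king_moves_def by (auto simp: prod_eq_iff)
      then show "t \<in> ?g ` king_moves"
        using de by (intro image_eqI[of _ _ "(d, e)"]) (auto simp: prod_eq_iff)
    qed
  qed
  then have "(\<Sum>t | t \<in> squares m n \<and> neighbors m n (a, b) t. f t) = (\<Sum>p\<in>king_moves. f (?g p))"
    by (rule sum.reindex_bij_betw[symmetric])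
  then show ?thesis by (simp add: case_prod_unfold)
qed

lemma neighbors_sym: "neighbors m n s t \<Longrightarrow> neighbors m n t s"
proof -
  have "\<exists>d\<in>{-1, 0, 1}. [b - a = d] (mod int k)" if ab: "\<exists>d\<in>{-1, 0, 1}. [a - b = d] (mod int k)" for a b :: int and k
  proof -
    obtain d where "d \<in> {-1, 0, 1}" "[a - b = d] (mod int k)" using ab by blast
    then have "- d \<in> {-1, 0, 1}" "[b - a = - d] (mod int k)"
      using cong_minus_minus_iff[of "a - b" d "int k"] by auto
    then show ?thesis by blast
  qed
  then show "neighbors m n s t \<Longrightarrow> neighbors m n t s"
    unfolding neighbors_def by metis
qed

section \<open>Fourier transform of a board\<close>

lemma power_int_mod_period:
  fixes z :: complex
  assumes "z ^ m = 1" "m > 0"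
  shows "z powi (k mod int m) = z powi k"
proof -
  have z: "z \<noteq> 0" using assms by (auto simp: power_0_left)
  have "z powi k = z powi (int m * (k div int m) + k mod int m)" by simp
  also have "\<dots> = (z powi int m) powi (k div int m) * z powi (k mod int m)"
    using z by (subst power_int_add) (simp_all add: power_int_mult)
  also have "\<dots> = z powi (k mod int m)" using assms by simp
  finally show ?thesis by simp
qed

lemma finite_squares: "finite (squares m n)"
  unfolding squares_def by simp

text \<open>Characters are eigenfunctions of the neighbor sum, which is a symmetric operator.
  Pairing with \<open>x\<close>, which the operator fixes, multiplies the coefficient by the
  eigenvalue; a non-zero coefficient forces this to be 1.\<close>

lemma fourier_coefficient_eigen:
  fixes z w :: complex
  assumes mn: "m \<ge> 3" "n \<ge> 3" and x: "neighbor_sum_property m n x"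
    and z: "z ^ m = 1" and w: "w ^ n = 1"
    and nonzero: "(\<Sum>s\<in>squares m n. of_int (x s) * (z powi fst s * w powi snd s)) \<noteq> 0"
  shows "(1 + z + 1 / z) * (1 + w + 1 / w) = 2"
proof -
  define \<chi> where "\<chi> s = z powi fst s * w powi snd s" for s
  \<comment> \<open>The product of trinomials sums over the whole 3 by 3 block; the 1 subtracted is
    the central square.\<close>
  let ?c = "(1 + z + 1 / z) * (1 + w + 1 / w) - 1"
  let ?S = "squares m n"
  have zw: "z \<noteq> 0" "w \<noteq> 0" using z w mn by (auto simp: power_0_left)
  have \<chi>: "(\<Sum>t | t \<in> ?S \<and> neighbors m n s t. \<chi> t) = ?c * \<chi> s" if "s \<in> ?S" for s
  proof -
    obtain a b where s: "s = (a, b)" by fastforce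
    have "(\<Sum>t | t \<in> ?S \<and> neighbors m n s t. \<chi> t) =
      (\<Sum>(d, e)\<in>king_moves. z powi ((a + d) mod int m) * w powi ((b + e) mod int n))"
      using sum_neighbors[OF mn, of a b \<chi>] that unfolding s \<chi>_def by simp
    also have "\<dots> = (\<Sum>(d, e)\<in>king_moves. (z powi a * z powi d) * (w powi b * w powi e))"
      using mn z w zw by (simp add: power_int_mod_period power_int_add)
    also have "\<dots> = ?c * \<chi> s"
      unfolding king_moves_eq s \<chi>_def using zw by (simp add: field_simps power_int_minus)
    finally show ?thesis .
  qed
  have "(\<Sum>s\<in>?S. of_int (x s) * \<chi> s) = (\<Sum>s\<in>?S. (\<Sum>t | t \<in> ?S \<and> neighbors m n s t. of_int (x t)) * \<chi> s)"
    using x unfolding neighbor_sum_property_def by (intro sum.cong) (auto simp flip: of_int_sum)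
  also have "\<dots> = (\<Sum>s\<in>?S. \<Sum>t | t \<in> ?S \<and> neighbors m n s t. of_int (x t) * \<chi> s)"
    by (simp add: sum_distrib_right)
  \<comment> \<open>Exchanging the sums and using \<open>neighbors_sym\<close> moves the operator
    from \<open>x\<close> to the character.\<close>
  also have "\<dots> = (\<Sum>t\<in>?S. \<Sum>s | s \<in> ?S \<and> neighbors m n s t. of_int (x t) * \<chi> s)"
    by (rule sum.swap_restrict[OF finite_squares finite_squares])
  also have "\<dots> = (\<Sum>t\<in>?S. of_int (x t) * (\<Sum>s | s \<in> ?S \<and> neighbors m n t s. \<chi> s))"
    unfolding sum_distrib_left
    by (intro sum.cong refl Collect_cong) (use neighbors_sym in blast)
  also have "\<dots> = (\<Sum>t\<in>?S. ?c * (of_int (x t) * \<chi> t))"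
    by (intro sum.cong refl) (simp only: \<chi> mult.left_commute)
  also have "\<dots> = ?c * (\<Sum>t\<in>?S. of_int (x t) * \<chi> t)"
    by (simp only: sum_distrib_left)
  finally have "?c = 1" using nonzero unfolding \<chi>_def[symmetric] by (simp del: of_int_sum)
  then show ?thesis by (simp add: algebra_simps)
qed

text \<open>The \<open>f i\<close> are the coefficients of a polynomial of degree below
  \<open>m\<close> that vanishes at all \<open>m\<close> roots of unity.\<close>

lemma fourier_coefficients_0_imp_0:
  fixes f :: "nat \<Rightarrow> complex"
  assumes m: "m > 0" and "\<And>z. z ^ m = 1 \<Longrightarrow> (\<Sum>i<m. f i * z ^ i) = 0" and i: "i < m"
  shows "f i = 0"
proof -
  define p where "p = (\<Sum>i<m. monom (f i) i)"
  have "p = 0"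
  proof (rule poly_eqI_degree)
    show "degree p < card {z :: complex. z ^ m = 1}"
      unfolding card_roots_unity_eq[OF m] p_def using m
      by (intro degree_sum_less) (auto intro: le_less_trans[OF degree_monom_le])
    then show "degree (0 :: complex poly) < card {z :: complex. z ^ m = 1}" by simp
  qed (use assms(2) in \<open>simp add: p_def poly_sum poly_monom\<close>)
  moreover have "coeff p i = f i" unfolding p_def using i by (simp add: coeff_sum sum.delta)
  ultimately show ?thesis by simp
qed

lemma nonzero_fourier_coefficient:
  assumes mn: "m > 0" "n > 0" and "\<not> trivial_board m n x"
  shows "\<exists>z w :: complex. z ^ m = 1 \<and> w ^ n = 1 \<and>
    (\<Sum>s\<in>squares m n. of_int (x s) * (z powi fst s * w powi snd s)) \<noteq> 0"
proof (rule ccontr)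
  assume zero: "\<not> ?thesis"
  have "x s = 0" if "s \<in> squares m n" for s
  proof -
    have int_image: "{0..<int k} = int ` {..<k}" for k
      by (simp add: image_int_atLeastLessThan lessThan_atLeast0)
    have "(\<Sum>i<m. (\<Sum>j<n. of_int (x (int i, int j)) * w ^ j) * z ^ i) = 0"
      if zw: "z ^ m = 1" "w ^ n = 1" for z w :: complex
    proof -
      have "(\<Sum>s\<in>squares m n. of_int (x s) * (z powi fst s * w powi snd s)) = 0"
        using zero zw by blast
      also have "(\<Sum>s\<in>squares m n. of_int (x s) * (z powi fst s * w powi snd s)) =
          (\<Sum>i<m. \<Sum>j<n. of_int (x (int i, int j)) * (z ^ i * w ^ j))"
        unfolding squares_def int_image
        by (simp add: sum.cartesian_product' sum.reindex case_prod_unfold flip: sum.cartesian_product)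
      finally show ?thesis by (simp add: sum_distrib_left sum_distrib_right mult_ac)
    qed
    \<comment> \<open>The one-dimensional inversion is applied in \<open>z\<close> for each fixed
      \<open>w\<close>, and then in \<open>w\<close> for each row \<open>i\<close>.\<close>
    then have "(\<Sum>j<n. of_int (x (int i, int j)) * w ^ j) = 0" if "w ^ n = 1" "i < m" for w :: complex and i
      using fourier_coefficients_0_imp_0[OF mn(1), of "\<lambda>i. \<Sum>j<n. of_int (x (int i, int j)) * w ^ j"] that by blast
    then have "of_int (x (int i, int j)) = (0 :: complex)" if "i < m" "j < n" for i j
      using fourier_coefficients_0_imp_0[OF mn(2), of "\<lambda>j. of_int (x (int i, int j))"] that by blast
    moreover obtain i j where "s = (int i, int j)" "i < m" "j < n"
      using \<open>s \<in> squares m n\<close> unfolding squares_def int_image by auto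
    ultimately show "x s = 0" by simp
  qed
  then show False using assms(3) unfolding trivial_board_def by blast
qed

section \<open>Boards built from integer waves\<close>

text \<open>The sum over a 3 by 3 block factors into two three-term sums and equals
  \<open>c * d = 2\<close> times the central entry; removing the center leaves that entry
  once.\<close>

lemma product_board:
  fixes f g :: "int \<Rightarrow> int"
  assumes mn: "m \<ge> 3" "n \<ge> 3"
    and f: "\<And>i. f (i mod int m) = f i" "\<And>i. f (i - 1) + f i + f (i + 1) = c * f i"
    and g: "\<And>j. g (j mod int n) = g j" "\<And>j. g (j - 1) + g j + g (j + 1) = d * g j"
    and cd: "c * d = 2"
  shows "neighbor_sum_property m n (\<lambda>s. f (fst s) * g (snd s))"
  unfolding neighbor_sum_property_def
proof
  fix s assume s: "s \<in> squares m n"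
  obtain a b where ab: "s = (a, b)" by fastforce
  have "(\<Sum>t | t \<in> squares m n \<and> neighbors m n s t. f (fst t) * g (snd t)) =
    (f (a - 1) + f a + f (a + 1)) * (g (b - 1) + g b + g (b + 1)) - f a * g b"
    using sum_neighbors[OF mn, of a b "\<lambda>t. f (fst t) * g (snd t)"] s
    unfolding ab king_moves_eq by (simp add: f(1) g(1) algebra_simps)
  also have "\<dots> = (c * d) * (f a * g b) - f a * g b" by (simp add: f(2) g(2))
  finally show "f (fst s) * g (snd s) = (\<Sum>t | t \<in> squares m n \<and> neighbors m n s t. f (fst t) * g (snd t))"
    by (simp add: ab cd)
qed

text \<open>This is \<open>cos (pi * i / 2)\<close>.\<close>

definition wave4 :: "int \<Rightarrow> int" where
  "wave4 i = (if i mod 4 = 0 then 1 else if i mod 4 = 2 then -1 else 0)"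

text \<open>This is \<open>cos (pi * j / 3 - pi / 6)\<close> scaled by \<open>2 / sqrt 3\<close>;
  the phase makes all values -1, 0 or 1.\<close>

definition wave6 :: "int \<Rightarrow> int" where
  "wave6 j = (if j mod 6 \<in> {0, 1} then 1 else if j mod 6 \<in> {3, 4} then -1 else 0)"

lemma wave4_eigen: "wave4 (i - 1) + wave4 i + wave4 (i + 1) = 1 * wave4 i"
proof -
  consider "i mod 4 = 0" | "i mod 4 = 1" | "i mod 4 = 2" | "i mod 4 = 3" by fastforce
  then show ?thesis
  proof cases
    case 1 then have "(i - 1) mod 4 = 3" "(i + 1) mod 4 = 1" by presburger+
    then show ?thesis using 1 by (simp add: wave4_def)
  next
    case 2 then have "(i - 1) mod 4 = 0" "(i + 1) mod 4 = 2" by presburger+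
    then show ?thesis using 2 by (simp add: wave4_def)
  next
    case 3 then have "(i - 1) mod 4 = 1" "(i + 1) mod 4 = 3" by presburger+
    then show ?thesis using 3 by (simp add: wave4_def)
  next
    case 4 then have "(i - 1) mod 4 = 2" "(i + 1) mod 4 = 0" by presburger+
    then show ?thesis using 4 by (simp add: wave4_def)
  qed
qed

lemma wave6_eigen: "wave6 (j - 1) + wave6 j + wave6 (j + 1) = 2 * wave6 j"
proof -
  consider "j mod 6 = 0" | "j mod 6 = 1" | "j mod 6 = 2" | "j mod 6 = 3" | "j mod 6 = 4" | "j mod 6 = 5"
    by fastforce
  then show ?thesis
  proof cases
    case 1 then have "(j - 1) mod 6 = 5" "(j + 1) mod 6 = 1" by presburger+
    then show ?thesis using 1 by (simp add: wave6_def)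
  next
    case 2 then have "(j - 1) mod 6 = 0" "(j + 1) mod 6 = 2" by presburger+
    then show ?thesis using 2 by (simp add: wave6_def)
  next
    case 3 then have "(j - 1) mod 6 = 1" "(j + 1) mod 6 = 3" by presburger+
    then show ?thesis using 3 by (simp add: wave6_def)
  next
    case 4 then have "(j - 1) mod 6 = 2" "(j + 1) mod 6 = 4" by presburger+
    then show ?thesis using 4 by (simp add: wave6_def)
  next
    case 5 then have "(j - 1) mod 6 = 3" "(j + 1) mod 6 = 5" by presburger+
    then show ?thesis using 5 by (simp add: wave6_def)
  next
    case 6 then have "(j - 1) mod 6 = 4" "(j + 1) mod 6 = 0" by presburger+
    then show ?thesis using 6 by (simp add: wave6_def)
  qed
qed

lemma wave4_mod: "4 dvd m \<Longrightarrow> wave4 (i mod int m) = wave4 i"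
  using int_dvd_int_iff[of 4 m] unfolding wave4_def by (simp add: mod_mod_cancel)

lemma wave6_mod: "6 dvd n \<Longrightarrow> wave6 (j mod int n) = wave6 j"
  using int_dvd_int_iff[of 6 n] unfolding wave6_def by (simp add: mod_mod_cancel)

section \<open>From roots of unity to the divisibility conditions\<close>

text \<open>Writing the inverse too as a natural power of one primitive root places both
  \<open>z\<close> and \<open>1 / z\<close> in the ring generated by that root.\<close>

lemma root_of_unity_power_cis:
  fixes z :: complex
  assumes "z ^ k = 1" "k > 0"
  obtains j where "z = cis (2 * pi / real k) ^ j" "1 / z = cis (2 * pi / real k) ^ (k * j - j)"
proof -
  obtain j where j: "z = cis (2 * pi * real j / real k)"
    using bij_betw_roots_unity[OF assms(2)] assms(1) unfolding bij_betw_def by blast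
  let ?c = "cis (2 * pi / real k)"
  have z: "z = ?c ^ j" unfolding j DeMoivre by (simp add: mult_ac)
  have "?c ^ k = 1" unfolding DeMoivre using assms(2) by simp
  then have "(?c ^ k) ^ j = 1" by simp
  \<comment> \<open>The natural subtraction is not truncated, because \<open>k > 0\<close> gives
    \<open>j \<le> k * j\<close>.\<close>
  moreover have "?c ^ (k * j - j) * ?c ^ j = ?c ^ (k * j)"
    using assms(2) by (simp flip: power_add)
  ultimately have "?c ^ (k * j - j) * z = 1" unfolding z by (simp add: power_mult)
  then have "1 / z = ?c ^ (k * j - j)" by (metis mult_zero_right nonzero_divide_eq_eq zero_neq_one)
  then show ?thesis using that z by blast
qed

text \<open>The hypothesis says \<open>z\<^sup>2 = -1\<close>, so \<open>z\<close> has order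
  4.\<close>

lemma trinomial_1_imp_dvd:
  fixes z :: complex
  assumes "1 + z + 1 / z = 1" "z ^ m = 1" "m > 0"
  shows "4 dvd m"
proof -
  have z0: "z \<noteq> 0" using assms by (auto simp: power_0_left)
  then have z2: "z\<^sup>2 = -1" using assms(1) by (simp add: field_simps power2_eq_square eq_neg_iff_add_eq_0)
  have z4: "z ^ 4 = 1" using z2 by Groebner_Basis.algebra
  have "z ^ m = z ^ (4 * (m div 4) + m mod 4)" by simp
  also have "\<dots> = z ^ (m mod 4)" by (simp only: power_add power_mult z4) simp
  finally have *: "z ^ (m mod 4) = 1" using assms(2) by simp
  have "z ^ r \<noteq> 1" if r: "r \<in> {1, 2, 3}" for r
  proof
    assume "z ^ r = 1"
    then consider "z ^ 1 = 1" | "z ^ 2 = 1" | "z ^ 3 = 1" using r by auto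
    then have "(2 :: complex) = 0"
      by cases (use z2 in Groebner_Basis.algebra)+
    then show False by simp
  qed
  then have "m mod 4 \<notin> {1, 2, 3}" using * by blast
  then show ?thesis by (simp add: dvd_eq_mod_eq_0) presburger
qed

text \<open>The hypothesis makes \<open>z\<close> a root of the sixth cyclotomic polynomial, so
  \<open>z\<close> has order 6.\<close>

lemma trinomial_2_imp_dvd:
  fixes z :: complex
  assumes "1 + z + 1 / z = 2" "z ^ m = 1" "m > 0"
  shows "6 dvd m"
proof -
  have z0: "z \<noteq> 0" using assms by (auto simp: power_0_left)
  have "z * 2 = z + z\<^sup>2 + 1"
    unfolding assms(1)[symmetric] using z0 by (simp add: distrib_left power2_eq_square)
  then have z2: "z\<^sup>2 = z - 1" by Groebner_Basis.algebra
  have z6: "z ^ 6 = 1" using z2 by Groebner_Basis.algebra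
  have "z ^ m = z ^ (6 * (m div 6) + m mod 6)" by simp
  also have "\<dots> = z ^ (m mod 6)" by (simp only: power_add power_mult z6) simp
  finally have *: "z ^ (m mod 6) = 1" using assms(2) by simp
  have "z ^ r \<noteq> 1" if r: "r \<in> {1, 2, 3, 4, 5}" for r
  proof
    assume "z ^ r = 1"
    then consider "z ^ 1 = 1" | "z ^ 2 = 1" | "z ^ 3 = 1" | "z ^ 4 = 1" | "z ^ 5 = 1" using r by auto
    \<comment> \<open>The five exponents yield 1, 3, 2, 3 and 1 equal to 0 respectively; 6 is a
      common multiple.\<close>
    then have "(6 :: complex) = 0"
      by cases (use z2 in Groebner_Basis.algebra)+
    then show False by simp
  qed
  then have "m mod 6 \<notin> {1, 2, 3, 4, 5}" using * by blast
  then show ?thesis by (simp add: dvd_eq_mod_eq_0) presburger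
qed

text \<open>Exchanging rows and columns preserves the property, hence the two symmetric
  alternatives.\<close>

theorem theorem15:
  fixes m n :: nat
  assumes "m \<ge> 3" and "n \<ge> 3"
  shows "(\<exists>x :: int \<times> int \<Rightarrow> int. neighbor_sum_property m n x \<and> \<not> trivial_board m n x) \<longleftrightarrow>
    (4 dvd m \<and> 6 dvd n) \<or> (6 dvd m \<and> 4 dvd n)"
proof
  assume "\<exists>x :: int \<times> int \<Rightarrow> int. neighbor_sum_property m n x \<and> \<not> trivial_board m n x"
  then obtain x where x: "neighbor_sum_property m n x" "\<not> trivial_board m n x" by blast
  have pos: "m > 0" "n > 0" "m * n > 0" using assms by auto
  obtain z w :: complex where z: "z ^ m = 1" and w: "w ^ n = 1"
    and nonzero: "(\<Sum>s\<in>squares m n. of_int (x s) * (z powi fst s * w powi snd s)) \<noteq> 0"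
    using nonzero_fourier_coefficient[OF pos(1,2) x(2)] by blast
  have uv: "(1 + z + 1 / z) * (1 + w + 1 / w) = 2"
    using fourier_coefficient_eigen[OF assms x(1) z w nonzero] .
  \<comment> \<open>A primitive root of order \<open>m * n\<close> provides one ring containing both
    \<open>z\<close> and \<open>w\<close>.\<close>
  define \<xi> where "\<xi> = cis (2 * pi / real (m * n))"
  interpret cyclotomic \<xi> "m * n"
    using pos by unfold_locales (simp_all add: \<xi>_def DeMoivre)
  have "z ^ (m * n) = 1" "w ^ (m * n) = 1"
    using z w by (metis power_mult power_one mult.commute)+
  then have "z \<in> R" "1 / z \<in> R" "w \<in> R" "1 / w \<in> R"
    using root_of_unity_power_cis[OF _ pos(3)] int_adjoin_power[OF int_adjoin.gen[of \<xi>]]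
    unfolding \<xi>_def by metis+
  then have "1 + z + 1 / z = 2 \<and> 1 + w + 1 / w = 1 \<or> 1 + z + 1 / z = 1 \<and> 1 + w + 1 / w = 2"
    using product_2_imp[of z m w n, OF _ _ z pos(1) _ _ w pos(2) refl refl uv] by blast
  then show "(4 dvd m \<and> 6 dvd n) \<or> (6 dvd m \<and> 4 dvd n)"
    using trinomial_1_imp_dvd trinomial_2_imp_dvd z w pos by blast
next
  \<comment> \<open>Both waves take the value 1 at 0, so the origin witnesses
    non-triviality.\<close>
  have origin: "(0, 0) \<in> squares m n" using assms unfolding squares_def by simp
  assume "(4 dvd m \<and> 6 dvd n) \<or> (6 dvd m \<and> 4 dvd n)"
  then show "\<exists>x :: int \<times> int \<Rightarrow> int. neighbor_sum_property m n x \<and> \<not> trivial_board m n x"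
  proof
    assume "4 dvd m \<and> 6 dvd n"
    then have "neighbor_sum_property m n (\<lambda>s. wave4 (fst s) * wave6 (snd s))"
      by (intro product_board[OF assms _ wave4_eigen _ wave6_eigen]) (simp_all add: wave4_mod wave6_mod)
    moreover have "\<not> trivial_board m n (\<lambda>s. wave4 (fst s) * wave6 (snd s))"
      using origin unfolding trivial_board_def by (force simp: wave4_def wave6_def)
    ultimately show ?thesis by blast
  next
    assume "6 dvd m \<and> 4 dvd n"
    then have "neighbor_sum_property m n (\<lambda>s. wave6 (fst s) * wave4 (snd s))"
      by (intro product_board[OF assms _ wave6_eigen _ wave4_eigen]) (simp_all add: wave4_mod wave6_mod)
    moreover have "\<not> trivial_board m n (\<lambda>s. wave6 (fst s) * wave4 (snd s))"
      using origin unfolding trivial_board_def by (force simp: wave4_def wave6_def)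
    ultimately show ?thesis by blast
  qed
qed

end
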